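(* For every real Banach space $X$ with $\dim X\ge 2$, $$\mathrm{DR}_B(X)=\sup\{\mathrm{DR}_B(E): E\subset X \text{ a linear subspace},\ 2\le\dim E<\infty\}.$$ In fact, the supremum can be taken over the two-dimensional subspaces generated by Birkhoff pairs, i.e. over $E=\operatorname{span}\{u,v\}$ with $u,v\in S_X$, $u\perp_B v$.
   Context: $S_X$ is the unit sphere of $X$. Birkhoff orthogonality: $x\perp_B y$ iff $\|x+\lambda y\|\ge\|x\|$ for all $\lambda\in\mathbb R$. For nonzero $x,y$ in a real Banach space $Z$ put $\alpha[x,y]=\left\|\frac{x}{\|x\|}-\frac{y}{\|y\|}\right\|$ and $\beta[x,y]=\left\|\frac{x}{\|y\|}-\frac{y}{\|x\|}\right\|$. The Birkhoff-orthogonal Dehghan--Rooin constant is $$\mathrm{DR}_B(Z)=\sup\left\{\frac{\alpha[x,y]}{\beta[x,y]}: x,y\in Z\setminus\{0\},\ x\perp_B y,\ \beta[x,y]\ne 0\right\}.$$ Subspaces carry the induced norm. *)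

theory Defs
  imports "HOL-Analysis.Analysis"
begin

definition birkhoff_orthogonal :: "'a::real_normed_vector \<Rightarrow> 'a \<Rightarrow> bool"
    (infix "\<bottom>\<^sub>B" 50)
  where "x \<bottom>\<^sub>B y \<longleftrightarrow> (\<forall>t::real. norm (x + t *\<^sub>R y) \<ge> norm x)"

definition dr_alpha :: "'a::real_normed_vector \<Rightarrow> 'a \<Rightarrow> real"
  where "dr_alpha x y = norm (x /\<^sub>R norm x - y /\<^sub>R norm y)"

definition dr_beta :: "'a::real_normed_vector \<Rightarrow> 'a \<Rightarrow> real"
  where "dr_beta x y = norm (x /\<^sub>R norm y - y /\<^sub>R norm x)"

text \<open>
  A subspace with its induced norm is represented by its underlying set, and the whole
  space by \<open>UNIV\<close>. The lemmas \<open>dr_ratios_bounded\<close> and \<open>dr_ratios_nonempty\<close> below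
  show that the supremum is that of a nonempty set of reals bounded above whenever the
  subspace has dimension at least two.
\<close>

definition dr_ratios :: "'a::real_normed_vector set \<Rightarrow> real set"
  where "dr_ratios Z =
    {dr_alpha x y / dr_beta x y | x y.
       x \<in> Z - {0} \<and> y \<in> Z - {0} \<and> x \<bottom>\<^sub>B y \<and> dr_beta x y \<noteq> 0}"

definition DR_B :: "'a::real_normed_vector set \<Rightarrow> real"
  where "DR_B Z = Sup (dr_ratios Z)"

text \<open>
  The constant \<open>dim\<close> returns \<open>0\<close> on infinite-dimensional spaces, so finiteness of the
  dimension has to be expressed separately.
\<close>

definition finite_dimensional :: "'a::real_vector set \<Rightarrow> bool"
  where "finite_dimensional V \<longleftrightarrow> (\<exists>B. finite B \<and> span B = V)"

definition dim_at_least_two :: "'a::real_vector set \<Rightarrow> bool"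
  where "dim_at_least_two V \<longleftrightarrow> (finite_dimensional V \<longrightarrow> 2 \<le> dim V)"

definition birkhoff_planes :: "'a::real_normed_vector set set"
  where "birkhoff_planes =
    {span {u, v} | u v. u \<in> sphere 0 1 \<and> v \<in> sphere 0 1 \<and> u \<bottom>\<^sub>B v}"

lemma dr_beta_ge_half:
  assumes "x \<noteq> 0" "y \<noteq> 0" "x \<bottom>\<^sub>B y"
  shows "dr_beta x y \<ge> 1/2"
proof -
  define a b where "a = norm x" and "b = norm y"
  have ab: "a > 0" "b > 0" using assms by (auto simp: a_def b_def)
  have eq: "x /\<^sub>R b - y /\<^sub>R a = (1/b) *\<^sub>R (x + (- (b/a)) *\<^sub>R y)"
    using ab by (simp add: scaleR_diff_right divide_inverse)
  have "norm (x + (- (b/a)) *\<^sub>R y) \<ge> a"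
    using assms(3) unfolding birkhoff_orthogonal_def a_def by blast
  then have 1: "dr_beta x y \<ge> a / b"
    using ab by (simp add: dr_beta_def eq divide_right_mono flip: a_def b_def)
  have "norm (y /\<^sub>R a) - norm (x /\<^sub>R b) \<le> norm (x /\<^sub>R b - y /\<^sub>R a)"
    by (subst norm_minus_commute) (rule norm_triangle_ineq2)
  moreover have "norm (y /\<^sub>R a) = b / a" "norm (x /\<^sub>R b) = a / b"
    using ab by (simp_all add: divide_inverse_commute flip: a_def b_def)
  ultimately have 2: "dr_beta x y \<ge> b / a - a / b"
    by (simp add: dr_beta_def a_def b_def)
  show ?thesis
  proof (cases "a / b \<ge> 1/2")
    case True then show ?thesis using 1 by linarith
  next
    case False
    then have "b / a \<ge> 2" using ab by (simp add: field_simps)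
    then show ?thesis using 2 False by linarith
  qed
qed

lemma dr_ratios_bounded: "bdd_above (dr_ratios Z)"
proof (rule bdd_aboveI)
  fix r assume "r \<in> dr_ratios Z"
  then obtain x y where r: "r = dr_alpha x y / dr_beta x y"
      and "x \<in> Z - {0}" "y \<in> Z - {0}" "x \<bottom>\<^sub>B y"
    unfolding dr_ratios_def mem_Collect_eq by (elim exE conjE) (rule that)
  then have xy: "x \<noteq> 0" "y \<noteq> 0" "x \<bottom>\<^sub>B y" by simp_all
  have "dr_alpha x y \<le> norm (x /\<^sub>R norm x) + norm (y /\<^sub>R norm y)"
    unfolding dr_alpha_def by (rule norm_triangle_ineq4)
  also have "\<dots> = 2" using xy by simp
  finally have "dr_alpha x y \<le> 2" .
  moreover have beta: "dr_beta x y \<ge> 1/2" using xy by (rule dr_beta_ge_half)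
  ultimately have "dr_alpha x y \<le> 4 * dr_beta x y" by linarith
  moreover have "dr_beta x y > 0" using beta by linarith
  ultimately show "r \<le> 4" unfolding r by (simp only: pos_divide_le_eq)
qed

lemma exists_birkhoff_orthogonal:
  fixes y z :: "'a::real_normed_vector"
  assumes "y \<noteq> 0"
  shows "\<exists>t. (z + t *\<^sub>R y) \<bottom>\<^sub>B y"
proof -
  define f where "f = (\<lambda>t. norm (z + t *\<^sub>R y))"
  define R where "R = 2 * norm z / norm y"
  have R: "R \<ge> 0" unfolding R_def by simp
  have "continuous_on {-R..R} f" unfolding f_def by (intro continuous_intros)
  then obtain s where s: "s \<in> {-R..R}" "\<And>t. t \<in> {-R..R} \<Longrightarrow> f s \<le> f t"
    using continuous_attains_inf[of "{-R..R}" f] R by fastforce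
  have all: "f s \<le> f t" for t
  proof (cases "t \<in> {-R..R}")
    case False
    then have "\<bar>t\<bar> > R" by auto
    then have "\<bar>t\<bar> * norm y > 2 * norm z" using assms by (simp add: R_def field_simps)
    moreover have "norm (t *\<^sub>R y) - norm z \<le> f t"
      using norm_diff_ineq[of "t *\<^sub>R y" z] by (simp add: f_def add.commute)
    moreover have "f s \<le> norm z" using s(2)[of 0] R by (simp add: f_def)
    ultimately show ?thesis by simp
  qed (use s in auto)
  have "(z + s *\<^sub>R y) \<bottom>\<^sub>B y"
    unfolding birkhoff_orthogonal_def
  proof
    fix t
    show "norm (z + s *\<^sub>R y) \<le> norm (z + s *\<^sub>R y + t *\<^sub>R y)"
      using all[of "s + t"] by (simp add: f_def algebra_simps)
  qed
  then show ?thesis by blast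
qed

lemma dr_ratios_nonempty:
  assumes "subspace V" "dim_at_least_two V"
  shows "dr_ratios V \<noteq> {}"
proof -
  have notsub: "\<not> V \<subseteq> span {y}" if "y \<in> V" for y
  proof
    assume "V \<subseteq> span {y}"
    moreover have "span {y} \<subseteq> V" using assms(1) that by (simp add: span_minimal)
    ultimately have eq: "span {y} = V" by blast
    then have "finite_dimensional V" unfolding finite_dimensional_def by blast
    then have "2 \<le> dim V" using assms(2) by (simp add: dim_at_least_two_def)
    moreover have "dim V \<le> card {y}" using eq by (intro dim_le_card) auto
    ultimately show False by simp
  qed
  obtain y where y: "y \<in> V" "y \<noteq> 0"
    using notsub[of 0] assms(1) by (auto simp: subspace_0)
  obtain z where z: "z \<in> V" "z \<notin> span {y}" using notsub[OF y(1)] by blast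
  obtain t where t: "(z + t *\<^sub>R y) \<bottom>\<^sub>B y" using exists_birkhoff_orthogonal[OF y(2)] by blast
  define x where "x = z + t *\<^sub>R y"
  have "x \<in> V" unfolding x_def using assms(1) y z by (simp add: subspace_add subspace_scale)
  moreover have "x \<noteq> 0"
  proof
    assume "x = 0"
    then have "z = (- t) *\<^sub>R y" unfolding x_def by (simp add: eq_neg_iff_add_eq_0)
    then show False using z by (simp add: span_base span_neg span_scale)
  qed
  moreover have "dr_beta x y \<noteq> 0"
    using dr_beta_ge_half[of x y] \<open>x \<noteq> 0\<close> y t by (auto simp: x_def)
  ultimately have "dr_alpha x y / dr_beta x y \<in> dr_ratios V"
    using y t unfolding dr_ratios_def x_def by blast
  then show ?thesis by blast
qed

end

theory Submission
  imports Defs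
begin

text \<open>
  Every ratio \<open>dr_alpha x y / dr_beta x y\<close> over the whole space is already realised in the plane
  spanned by the Birkhoff pair \<open>x / \<parallel>x\<parallel>\<close>, \<open>y / \<parallel>y\<parallel>\<close>. Hence the
  ratio set of the space is the union of the ratio sets of any family of at least two-dimensional
  subspaces containing these planes, and an iterated supremum is the supremum over the union.
\<close>

text \<open>For \<open>a \<noteq> 0\<close> the factor \<open>a\<close> comes out of the norm and
  \<open>b / a\<close> is absorbed into the real parameter. This lets a Birkhoff pair be normalised
  to the unit sphere.\<close>

lemma birkhoff_orthogonal_scaleR:
  assumes "x \<bottom>\<^sub>B y"
  shows "(a *\<^sub>R x) \<bottom>\<^sub>B (b *\<^sub>R y)"
proof (cases "a = 0")
  case False
  show ?thesis
    unfolding birkhoff_orthogonal_def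
  proof
    fix t
    have "a *\<^sub>R x + t *\<^sub>R b *\<^sub>R y = a *\<^sub>R (x + (t * b / a) *\<^sub>R y)"
      using False by (simp add: scaleR_add_right)
    moreover have "norm x \<le> norm (x + (t * b / a) *\<^sub>R y)"
      using assms unfolding birkhoff_orthogonal_def by blast
    ultimately show "norm (a *\<^sub>R x) \<le> norm (a *\<^sub>R x + t *\<^sub>R b *\<^sub>R y)"
      by (simp add: mult_left_mono)
  qed
qed (simp add: birkhoff_orthogonal_def)

text \<open>If \<open>x = c *\<^sub>R y\<close>, the parameter \<open>- c\<close> would push the
  norm down to 0, below \<open>norm x\<close>. Hence Birkhoff pairs of unit vectors really span
  planes.\<close>

lemma birkhoff_orthogonal_notin_span:
  assumes "x \<bottom>\<^sub>B y" "x \<noteq> 0"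
  shows "x \<notin> span {y}"
proof
  assume "x \<in> span {y}"
  then obtain c where "x = c *\<^sub>R y"
    by (auto simp: span_singleton)
  then have "norm (x + (- c) *\<^sub>R y) = 0"
    by simp
  moreover have "norm x \<le> norm (x + (- c) *\<^sub>R y)"
    using assms(1) unfolding birkhoff_orthogonal_def by blast
  ultimately show False
    using assms(2) by (simp only: norm_le_zero_iff)
qed

lemma birkhoff_plane_dim:
  assumes "E \<in> birkhoff_planes"
  shows "subspace E" "finite_dimensional E" "dim E = 2"
proof -
  obtain u v where uv: "E = span {u, v}" "norm u = 1" "norm v = 1" "u \<bottom>\<^sub>B v"
    using assms by (auto simp: birkhoff_planes_def)
  show "subspace E"
    by (simp add: uv(1))
  show "finite_dimensional E"
    unfolding uv(1) finite_dimensional_def by (intro exI[of _ "{u, v}"]) simp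
  have nz: "u \<noteq> 0" "v \<noteq> 0"
    using uv by auto
  have u: "u \<notin> span {v}"
    using birkhoff_orthogonal_notin_span uv(4) nz(1) .
  then have "u \<noteq> v"
    by (auto simp: span_base)
  moreover have "independent {u, v}"
    using u nz by (simp add: independent_insert)
  ultimately show "dim E = 2"
    unfolding uv(1) by (simp add: dim_eq_card_independent)
qed

lemma dr_ratios_subset_birkhoff_planes:
  "dr_ratios (UNIV :: 'a::real_normed_vector set) \<subseteq> (\<Union>E\<in>(birkhoff_planes :: 'a set set). dr_ratios E)"
proof
  fix r
  assume "r \<in> dr_ratios (UNIV :: 'a set)"
  then obtain x y :: 'a where r: "r = dr_alpha x y / dr_beta x y"
      and xy: "x \<noteq> 0" "y \<noteq> 0" "x \<bottom>\<^sub>B y" "dr_beta x y \<noteq> 0"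
    unfolding dr_ratios_def by blast
  define u v where "u = x /\<^sub>R norm x" and "v = y /\<^sub>R norm y"
  have "u \<bottom>\<^sub>B v"
    unfolding u_def v_def by (rule birkhoff_orthogonal_scaleR) fact
  moreover have "u \<in> sphere 0 1" "v \<in> sphere 0 1"
    using xy by (simp_all add: u_def v_def)
  ultimately have plane: "span {u, v} \<in> birkhoff_planes"
    unfolding birkhoff_planes_def by blast
  \<comment> \<open>The ratio is not invariant under scaling \<open>x\<close> and \<open>y\<close>
    separately, so the original vectors, not \<open>u\<close> and \<open>v\<close>, must be found in
    the plane.\<close>
  have "norm x *\<^sub>R u \<in> span {u, v}" "norm y *\<^sub>R v \<in> span {u, v}"
    by (simp_all add: span_base span_scale)
  then have "x \<in> span {u, v}" "y \<in> span {u, v}"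
    using xy by (simp_all add: u_def v_def)
  then have "r \<in> dr_ratios (span {u, v})"
    using r xy unfolding dr_ratios_def by blast
  then show "r \<in> (\<Union>E\<in>(birkhoff_planes :: 'a set set). dr_ratios E)"
    using plane by blast
qed

text \<open>Stated for an arbitrary family \<open>F\<close> so that one argument serves both
  suprema: all finite-dimensional subspaces of dimension at least two, and only the Birkhoff
  planes.\<close>

lemma DR_B_UNIV_eq_Sup:
  fixes F :: "'a::real_normed_vector set set"
  assumes "dim_at_least_two (UNIV :: 'a set)"
    and planes: "birkhoff_planes \<subseteq> F"
    and F: "\<And>E. E \<in> F \<Longrightarrow> subspace E \<and> dim_at_least_two E"
  shows "DR_B (UNIV :: 'a set) = (SUP E\<in>F. DR_B E)"
proof -
  \<comment> \<open>Orthogonality, \<open>dr_alpha\<close> and \<open>dr_beta\<close> use only the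
    ambient norm, so a pair in \<open>E\<close> gives the same ratio in \<open>UNIV\<close>.\<close>
  have "(\<Union>E\<in>F. dr_ratios E) \<subseteq> dr_ratios (UNIV :: 'a set)"
    unfolding dr_ratios_def by blast
  then have union: "dr_ratios (UNIV :: 'a set) = (\<Union>E\<in>F. dr_ratios E)"
    using dr_ratios_subset_birkhoff_planes planes by blast
  moreover have "dr_ratios (UNIV :: 'a set) \<noteq> {}"
    using assms(1) by (simp add: dr_ratios_nonempty)
  ultimately have "F \<noteq> {}"
    by blast
  \<comment> \<open>Real suprema can be iterated over the union because \<open>F\<close> and each
    inner set are nonempty and the whole union is bounded above.\<close>
  moreover have "\<forall>E\<in>F. dr_ratios E \<noteq> {}"
    using F by (simp add: dr_ratios_nonempty)
  moreover have "bdd_above (\<Union>E\<in>F. dr_ratios E)"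
    using dr_ratios_bounded[of "UNIV :: 'a set"] unfolding union .
  ultimately show ?thesis
    using cSUP_UNION[of F dr_ratios "\<lambda>r. r"] by (simp add: DR_B_def union)
qed

theorem proposition2p8:
  assumes "dim_at_least_two (UNIV :: 'a::banach set)"
  shows "DR_B (UNIV :: 'a set) =
           Sup {DR_B E | E :: 'a set. subspace E \<and> finite_dimensional E \<and> 2 \<le> dim E}
       \<and> (\<forall>E \<in> (birkhoff_planes :: 'a set set). subspace E \<and> finite_dimensional E \<and> dim E = 2)
       \<and> DR_B (UNIV :: 'a set) = Sup {DR_B E | E :: 'a set. E \<in> birkhoff_planes}"
proof (intro conjI ballI)
  have "DR_B (UNIV :: 'a set) =
      (SUP E\<in>{E :: 'a set. subspace E \<and> finite_dimensional E \<and> 2 \<le> dim E}. DR_B E)"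
    by (rule DR_B_UNIV_eq_Sup[OF assms]) (auto simp: birkhoff_plane_dim dim_at_least_two_def)
  then show "DR_B (UNIV :: 'a set) =
      Sup {DR_B E | E :: 'a set. subspace E \<and> finite_dimensional E \<and> 2 \<le> dim E}"
    by (simp only: setcompr_eq_image)
  have "DR_B (UNIV :: 'a set) = (SUP E\<in>(birkhoff_planes :: 'a set set). DR_B E)"
    by (rule DR_B_UNIV_eq_Sup[OF assms]) (auto simp: birkhoff_plane_dim dim_at_least_two_def)
  then show "DR_B (UNIV :: 'a set) = Sup {DR_B E | E :: 'a set. E \<in> birkhoff_planes}"
    by (simp only: Setcompr_eq_image)
qed (use birkhoff_plane_dim in blast)+

end
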